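(* Let $M$ be a finite loopless matroid with ground set $E$ and rank function $r$, and let $d$ be a real number such that for all $A\subseteq E$ with $r(E\setminus A)<r(E)$ we have \[d\le\frac{|A|}{r(E)-r(E\setminus A)}.\] Then there exists a mapping $\phi$ of $E$ to the circle $S_d$ such that for every point $x$ of the circle, the set $\{\,e\in E\mid\phi(e)\in[\,x,x+1\,)\,\}$ spans $E$.
   Context: $S_d=\mathbb{R}/d\mathbb{R}$ is the circle of circumference $d$; $[x,x+1)$ denotes the cyclic (left-closed, right-open) interval of length $1$ starting at $x$ in the positive direction. A set spans $E$ if its rank equals $r(E)$. *)

theory Defs
  imports "HOL-Library.Real_Mod"
begin

locale finite_matroid =
  fixes E :: "'a set" and indep :: "'a set \<Rightarrow> bool"
  assumes finite_ground: "finite E"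
    and indep_subset_ground: "indep I \<Longrightarrow> I \<subseteq> E"
    and indep_empty: "indep {}"
    and indep_subset: "indep J \<Longrightarrow> I \<subseteq> J \<Longrightarrow> indep I"
    and indep_augment:
      "indep I \<Longrightarrow> indep J \<Longrightarrow> card I < card J \<Longrightarrow> \<exists>x\<in>J - I. indep (insert x I)"

definition rank_of :: "('a set \<Rightarrow> bool) \<Rightarrow> 'a set \<Rightarrow> nat" where
  "rank_of indep A = Max (card ` {I. I \<subseteq> A \<and> indep I})"

definition loopless :: "'a set \<Rightarrow> ('a set \<Rightarrow> bool) \<Rightarrow> bool" where
  "loopless E indep \<longleftrightarrow> (\<forall>e\<in>E. indep {e})"

definition spanning :: "'a set \<Rightarrow> ('a set \<Rightarrow> bool) \<Rightarrow> 'a set \<Rightarrow> bool" where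
  "spanning E indep A \<longleftrightarrow> A \<subseteq> E \<and> rank_of indep A = rank_of indep E"

text \<open>
  The circle of circumference \<open>d > 0\<close> is the quotient of the reals by the integer multiples
  of \<open>d\<close>; its points are the congruence classes modulo \<open>d\<close>.
\<close>

definition circle_rel :: "real \<Rightarrow> (real \<times> real) set" where
  "circle_rel d = {(s, t). [s = t] (rmod d)}"

definition circle :: "real \<Rightarrow> real set set" where
  "circle d = UNIV // circle_rel d"

definition circle_pt :: "real \<Rightarrow> real \<Rightarrow> real set" where
  "circle_pt d t = circle_rel d `` {t}"

text \<open>
  The cyclic interval \<open>[x, x + 1)\<close> is the image in the circle of \<open>[t, t + 1)\<close>, where \<open>t\<close> is
  any real representative of \<open>x\<close>. For \<open>d \<le> 1\<close> it wraps around and is the whole circle.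
\<close>

definition unit_arc :: "real \<Rightarrow> real set \<Rightarrow> real set set" where
  "unit_arc d x = (\<Union>t\<in>x. circle_pt d ` {t..<t + 1})"

lemma equiv_circle_rel: "equiv UNIV (circle_rel d)"
  by (rule equivI) (auto simp: circle_rel_def refl_on_def sym_def trans_def
      intro: rcong_sym rcong_trans)

lemma unit_arc_circle_pt: "unit_arc d (circle_pt d t) = circle_pt d ` {t..<t + 1}"
proof
  show "circle_pt d ` {t..<t + 1} \<subseteq> unit_arc d (circle_pt d t)"
    by (auto simp: unit_arc_def circle_pt_def circle_rel_def)
next
  show "unit_arc d (circle_pt d t) \<subseteq> circle_pt d ` {t..<t + 1}"
  proof
    fix y assume "y \<in> unit_arc d (circle_pt d t)"
    then obtain u s where u: "[t = u] (rmod d)" and s: "u \<le> s" "s < u + 1"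
      and y: "y = circle_pt d s"
      by (auto simp: unit_arc_def circle_pt_def circle_rel_def)
    have "[t + (s - u) = u + (s - u)] (rmod d)"
      using u by (simp only: rcong_add_right_cancel)
    then have "[t + (s - u) = s] (rmod d)" by simp
    then have "circle_pt d (t + (s - u)) = y"
      unfolding y circle_pt_def
      by (intro equiv_class_eq[OF equiv_circle_rel]) (simp add: circle_rel_def)
    moreover have "t + (s - u) \<in> {t..<t + 1}" using s by simp
    ultimately show "y \<in> circle_pt d ` {t..<t + 1}" by blast
  qed
qed

end

(* The minimal ratio card A / (r E - r (E - A)) is a rational p/k >= d, so after rescaling it suffices
   to place the elements in Z/p such that every k consecutive points carry a spanning set. Passing to
   the dual matroid, every element e is active during p - k consecutive times from phi e on, and the
   set of active elements has to be independent at all times.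

   As long as it is not, some element e lies in the span of the other elements that are active at
   the starting time of e; postpone ("push") a lowest such e by one. Removing e at its starting time
   keeps the span there, so the spans of the active sets never shrink. If this goes on for ever, let
   A be the set of elements pushed infinitely often. Always pushing a lowest element makes A rise
   above the others, after which no element outside A is pushable, every active set spans A, and
   its part outside A is independent over A. Hence at each of the p times at least r*(A) elements
   of A are active, whereas the density hypothesis allows at most p r*(A) in total. So the active
   sets are bases within A and independent over A, that is, independent: a contradiction. *)

theory Submission
  imports Defs "HOL-Library.Infinite_Set"
begin

section \<open>Rank functions on a finite ground set\<close>

text \<open>These axioms describe matroids by their ranks rather than by independent sets, because
  the rank of the dual is given by an explicit formula.\<close>

locale rank_function =
  fixes E :: "'a set" and r :: "'a set \<Rightarrow> nat"
  assumes finite_ground: "finite E"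
    and rank_empty: "r {} = 0"
    and rank_singleton: "e \<in> E \<Longrightarrow> r {e} \<le> 1"
    and rank_mono: "X \<subseteq> Y \<Longrightarrow> Y \<subseteq> E \<Longrightarrow> r X \<le> r Y"
    and rank_submodular: "X \<subseteq> E \<Longrightarrow> Y \<subseteq> E \<Longrightarrow> r (X \<union> Y) + r (X \<inter> Y) \<le> r X + r Y"
begin

lemma rank_Un_le_card:
  assumes "X \<subseteq> E" "Y \<subseteq> E"
  shows "r (X \<union> Y) \<le> r X + card Y"
proof -
  have "finite Y" using assms(2) finite_ground finite_subset by blast
  then show ?thesis using assms(2)
  proof (induction Y)
    case (insert e Y)
    have "r ((X \<union> Y) \<union> {e}) + r ((X \<union> Y) \<inter> {e}) \<le> r (X \<union> Y) + r {e}"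
      using insert assms by (intro rank_submodular) auto
    moreover have "r {e} \<le> 1" using insert by (intro rank_singleton) auto
    ultimately show ?case using insert by simp
  qed simp
qed

lemma rank_le_card: "X \<subseteq> E \<Longrightarrow> r X \<le> card X"
  using rank_Un_le_card[of "{}" X] by (simp add: rank_empty)

text \<open>The equation \<open>r (insert e X) = r X\<close> encodes that \<open>e\<close> lies in
  the span of \<open>X\<close>, here and below; spans grow with the set by submodularity.\<close>

lemma rank_insert_eq_mono:
  assumes "r (insert e X) = r X" "X \<subseteq> Y" "Y \<subseteq> E" "e \<in> E"
  shows "r (insert e Y) = r Y"
proof (cases "e \<in> Y")
  case False
  then have "insert e X \<union> Y = insert e Y" "insert e X \<inter> Y = X" using assms by auto
  then have "r (insert e Y) + r X \<le> r (insert e X) + r Y"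
    using rank_submodular[of "insert e X" Y] assms by auto
  moreover have "r Y \<le> r (insert e Y)" using assms by (intro rank_mono) auto
  ultimately show ?thesis using assms by simp
qed (simp add: insert_absorb)

lemma rank_Un_eq:
  assumes "\<And>e. e \<in> A \<Longrightarrow> r (insert e X) = r X" "X \<subseteq> E" "A \<subseteq> E"
  shows "r (A \<union> X) = r X"
proof -
  have "finite A" using assms(3) finite_ground finite_subset by blast
  then show ?thesis using assms
  proof (induction A)
    case (insert e A)
    have "r (insert e (A \<union> X)) = r (A \<union> X)"
      by (rule rank_insert_eq_mono[of _ X]) (use insert.prems in auto)
    then show ?case using insert by simp
  qed simp
qed

text \<open>By submodularity a coloop of \<open>X\<close> stays a coloop of every subset containing
  it, so deleting the elements of \<open>N\<close> one by one costs a unit of rank each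
  time.\<close>

lemma rank_Diff_coloops:
  assumes "X \<subseteq> E" "N \<subseteq> X" "\<And>f. f \<in> N \<Longrightarrow> r (X - {f}) < r X"
  shows "r (X - N) + card N \<le> r X"
proof -
  have "finite N" using assms(1,2) finite_ground by (metis finite_subset)
  then show ?thesis using assms(2,3)
  proof (induction N)
    case (insert f N)
    have "(X - {f}) \<union> (X - N) = X" "(X - {f}) \<inter> (X - N) = X - insert f N"
      using insert by auto
    then have "r X + r (X - insert f N) \<le> r (X - {f}) + r (X - N)"
      using rank_submodular[of "X - {f}" "X - N"] assms(1) by auto
    moreover have "r (X - {f}) < r X" by (rule insert.prems(2)) simp
    moreover have "r (X - N) + card N \<le> r X" using insert.prems by (intro insert.IH) auto
    ultimately show ?case using insert.hyps by simp
  qed simp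
qed

end

section \<open>Residues and cyclic windows\<close>

text \<open>Used for the age \<open>(t - \<phi> e) mod D\<close> of an element at time
  \<open>t\<close>: a push of \<open>e\<close>, or a step back in time, lowers it by one, wrapping
  from \<open>0\<close> to \<open>D - 1\<close>.\<close>

lemma minus_one_mod_int:
  fixes a D :: int
  assumes "D > 0"
  shows "(a - 1) mod D = (if a mod D = 0 then D - 1 else a mod D - 1)"
proof -
  have *: "(a - 1) mod D = (a mod D - 1) mod D" by (simp add: mod_diff_left_eq)
  show ?thesis
  proof (cases "a mod D = 0")
    case False
    have "0 \<le> a mod D" "a mod D < D" using assms by auto
    then have "(a mod D - 1) mod D = a mod D - 1"
      using False by (intro mod_pos_pos_trivial) auto
    then show ?thesis using False * by simp
  qed (use * assms in \<open>simp add: zmod_minus1\<close>)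
qed

lemma card_residues_less:
  fixes D w s :: int
  assumes "0 \<le> w" "w \<le> D" "D > 0"
  shows "card {t \<in> {0..<D}. (t - s) mod D < w} = nat w"
proof -
  have "bij_betw (\<lambda>j. (j + s) mod D) {0..<w} {t \<in> {0..<D}. (t - s) mod D < w}"
  proof (rule bij_betw_byWitness[where f' = "\<lambda>t. (t - s) mod D"])
    have sub: "((j + s) mod D - s) mod D = j mod D" for j by (simp add: mod_simps)
    show "\<forall>j\<in>{0..<w}. ((j + s) mod D - s) mod D = j" using assms by (auto simp: sub)
    show "\<forall>t\<in>{t \<in> {0..<D}. (t - s) mod D < w}. ((t - s) mod D + s) mod D = t"
      by (auto simp: mod_simps)
    show "(\<lambda>j. (j + s) mod D) ` {0..<w} \<subseteq> {t \<in> {0..<D}. (t - s) mod D < w}"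
      using assms by (auto simp: sub)
    show "(\<lambda>t. (t - s) mod D) ` {t \<in> {0..<D}. (t - s) mod D < w} \<subseteq> {0..<w}"
      using assms by auto
  qed
  from bij_betw_same_card[OF this] show ?thesis by simp
qed

section \<open>Active sets and pushes\<close>

locale circular_placement = rank_function +
  fixes D w :: int
  assumes w_nonneg: "0 \<le> w" and w_less: "w < D"
begin

text \<open>Times matter only modulo \<open>D\<close>, but the positions \<open>\<phi> e\<close> are
  unreduced integers, so that heights can be compared and pushes only raise them.\<close>

definition active :: "('a \<Rightarrow> int) \<Rightarrow> int \<Rightarrow> 'a set" where
  "active \<phi> t = {e \<in> E. (t - \<phi> e) mod D < w}"

text \<open>The rank equation puts \<open>e\<close> in the span of the others active at its start;
  the membership excludes the trivial case where deleting \<open>e\<close> changes nothing.\<close>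

definition pushable :: "('a \<Rightarrow> int) \<Rightarrow> 'a \<Rightarrow> bool" where
  "pushable \<phi> e \<longleftrightarrow> e \<in> active \<phi> (\<phi> e) \<and>
     r (active \<phi> (\<phi> e) - {e}) = r (active \<phi> (\<phi> e))"

definition push :: "('a \<Rightarrow> int) \<Rightarrow> 'a \<Rightarrow> 'a \<Rightarrow> int" where
  "push \<phi> e = \<phi>(e := \<phi> e + 1)"

lemma D_pos: "D > 0" using w_nonneg w_less by simp

lemma active_subset: "active \<phi> t \<subseteq> E" by (auto simp: active_def)

lemma finite_active [simp]: "finite (active \<phi> t)"
  using active_subset finite_ground finite_subset by blast

lemma active_cong: "(t - s) mod D = 0 \<Longrightarrow> active \<phi> t = active \<phi> s"
proof -
  assume "(t - s) mod D = 0"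
  then have "(t - \<phi> e) mod D = (s - \<phi> e) mod D" for e
    by (metis mod_eq_dvd_iff mod_0_imp_dvd diff_diff_eq2 diff_add_cancel mod_diff_cong)
  then show ?thesis by (simp add: active_def)
qed

text \<open>Double counting: each element is active at exactly \<open>w\<close> of the
  \<open>D\<close> times.\<close>

lemma sum_card_active:
  assumes "A \<subseteq> E"
  shows "(\<Sum>t\<in>{0..<D}. card (active \<phi> t \<inter> A)) = nat w * card A"
proof -
  have fin: "finite A" using assms finite_ground finite_subset by blast
  have "(\<Sum>t\<in>{0..<D}. card (active \<phi> t \<inter> A))
      = (\<Sum>t\<in>{0..<D}. \<Sum>e\<in>A. if (t - \<phi> e) mod D < w then 1 else 0)"
  proof (intro sum.cong refl)
    fix t
    have "active \<phi> t \<inter> A = {e \<in> A. (t - \<phi> e) mod D < w}" using assms by (auto simp: active_def)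
    then show "card (active \<phi> t \<inter> A) = (\<Sum>e\<in>A. if (t - \<phi> e) mod D < w then 1 else 0)"
      using fin by (simp add: sum.If_cases Int_def)
  qed
  also have "\<dots> = (\<Sum>e\<in>A. \<Sum>t\<in>{0..<D}. if (t - \<phi> e) mod D < w then 1 else 0)"
    by (rule sum.swap)
  also have "\<dots> = (\<Sum>e\<in>A. card {t\<in>{0..<D}. (t - \<phi> e) mod D < w})"
    by (intro sum.cong refl) (simp add: sum.If_cases Int_def)
  also have "\<dots> = (\<Sum>e\<in>A. nat w)"
    by (intro sum.cong refl card_residues_less) (use w_nonneg w_less in auto)
  finally show ?thesis by simp
qed

lemma mem_active_push_neq: "f \<noteq> e \<Longrightarrow> f \<in> active (push \<phi> e) t \<longleftrightarrow> f \<in> active \<phi> t"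
  by (simp add: active_def push_def)

lemma mem_active_push_self:
  "e \<in> active (push \<phi> e) t \<longleftrightarrow> e \<in> E \<and> (t - \<phi> e - 1) mod D < w"
  by (simp add: active_def push_def diff_diff_eq)

text \<open>The age of \<open>e\<close> wraps from \<open>0\<close> to \<open>D - 1\<close>, which
  lies outside the active window because \<open>w < D\<close>.\<close>

lemma active_push_start:
  assumes "(t - \<phi> e) mod D = 0"
  shows "active (push \<phi> e) t = active \<phi> t - {e}"
proof (rule set_eqI)
  fix f
  show "f \<in> active (push \<phi> e) t \<longleftrightarrow> f \<in> active \<phi> t - {e}"
  proof (cases "f = e")
    case True
    have "(t - \<phi> e - 1) mod D = D - 1" using minus_one_mod_int[OF D_pos] assms by metis
    then show ?thesis using True w_less by (simp add: mem_active_push_self)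
  qed (simp add: mem_active_push_neq)
qed

lemma active_push_mono:
  assumes "(t - \<phi> e) mod D \<noteq> 0"
  shows "active \<phi> t \<subseteq> active (push \<phi> e) t"
proof
  fix f assume f: "f \<in> active \<phi> t"
  show "f \<in> active (push \<phi> e) t"
  proof (cases "f = e")
    case True
    have "(t - \<phi> e - 1) mod D = (t - \<phi> e) mod D - 1"
      using minus_one_mod_int[OF D_pos] assms by metis
    then show ?thesis using f unfolding True mem_active_push_self by (simp add: active_def)
  qed (use f in \<open>simp add: mem_active_push_neq\<close>)
qed

text \<open>
  A set that is dependent over \<open>A\<close> and active at time \<open>t\<close> contains a minimal one \<open>C\<close>. No element of
  \<open>C\<close> can start while \<open>C\<close> is active, so \<open>C\<close> was active at all earlier times as well; but these
  include a starting time of each of its elements.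
\<close>

lemma active_independent_over:
  assumes A: "A \<subseteq> E"
    and start: "\<And>f. f \<in> E - A \<Longrightarrow> f \<in> active \<phi> (\<phi> f) \<Longrightarrow>
      r (A \<union> active \<phi> (\<phi> f) - {f}) < r (A \<union> active \<phi> (\<phi> f))"
  shows "r (A \<union> active \<phi> t) = r A + card (active \<phi> t - A)"
proof (rule ccontr)
  define bad where "bad C \<longleftrightarrow> C \<subseteq> E - A \<and> r (A \<union> C) < r A + card C" for C
  assume neq: "\<not> ?thesis"
  have "r (A \<union> (active \<phi> t - A)) \<le> r A + card (active \<phi> t - A)"
    using A active_subset by (intro rank_Un_le_card) auto
  then have "bad (active \<phi> t - A)" using neq active_subset by (auto simp: bad_def)
  then have "active \<phi> t - A \<subseteq> active \<phi> t \<and> bad (active \<phi> t - A)" by blast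
  then obtain C where C: "C \<subseteq> active \<phi> t" "bad C"
    and minimal: "\<And>C'. C' \<subseteq> active \<phi> t \<Longrightarrow> bad C' \<Longrightarrow> card C \<le> card C'"
    using ex_has_least_nat[of "\<lambda>C. C \<subseteq> active \<phi> t \<and> bad C" _ card] by metis
  have CE: "C \<subseteq> E - A" and fin: "finite C"
    using C finite_subset[OF C(1) finite_active] by (auto simp: bad_def)
  \<comment> \<open>\<open>C\<close> is a circuit after contracting \<open>A\<close>: by minimality
    \<open>C - {f}\<close> is independent over \<open>A\<close>, while \<open>C\<close> is
    not.\<close>
  have spanned: "r (insert f (A \<union> (C - {f}))) = r (A \<union> (C - {f}))" if f: "f \<in> C" for f
  proof -
    have "card (C - {f}) < card C" using f fin by (meson card_Diff1_less)
    then have "\<not> bad (C - {f})" using minimal[of "C - {f}"] C(1) by fastforce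
    then have "r A + card (C - {f}) \<le> r (A \<union> (C - {f}))"
      using CE unfolding bad_def by auto
    moreover have "card C = Suc (card (C - {f}))" using f fin by (metis card_Suc_Diff1)
    moreover have "r (A \<union> C) < r A + card C" using C by (simp add: bad_def)
    moreover have "r (A \<union> (C - {f})) \<le> r (A \<union> C)" using A CE by (intro rank_mono) auto
    moreover have "insert f (A \<union> (C - {f})) = A \<union> C" using f by auto
    ultimately show ?thesis by simp
  qed
  have no_start: "(s - \<phi> f) mod D \<noteq> 0" if s: "C \<subseteq> active \<phi> s" and f: "f \<in> C" for s f
  proof
    assume "(s - \<phi> f) mod D = 0"
    then have eq: "active \<phi> s = active \<phi> (\<phi> f)" by (rule active_cong)
    have "r (insert f (A \<union> active \<phi> s - {f})) = r (A \<union> active \<phi> s - {f})"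
      by (rule rank_insert_eq_mono[OF spanned[OF f]])
        (use A f CE active_subset[of \<phi> s] s in blast)+
    moreover have "insert f (A \<union> active \<phi> s - {f}) = A \<union> active \<phi> s" using s f by auto
    moreover have "r (A \<union> active \<phi> s - {f}) < r (A \<union> active \<phi> s)"
      unfolding eq by (rule start) (use s f CE eq in blast)+
    ultimately show False by simp
  qed
  have earlier: "C \<subseteq> active \<phi> (t - int n)" for n
  proof (induction n)
    case (Suc n)
    show ?case
    proof
      fix f assume f: "f \<in> C"
      then have "f \<in> active \<phi> (t - int n)" using Suc by blast
      then have "(t - int n - \<phi> f) mod D < w" "f \<in> E" by (simp_all add: active_def)
      moreover have "(t - int n - \<phi> f) mod D \<noteq> 0" using no_start[OF Suc f] .
      ultimately have "(t - int n - \<phi> f - 1) mod D < w"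
        using minus_one_mod_int[OF D_pos, of "t - int n - \<phi> f"] by simp
      moreover have "t - int n - \<phi> f - 1 = t - int (Suc n) - \<phi> f" by simp
      ultimately show "f \<in> active \<phi> (t - int (Suc n))"
        unfolding active_def using \<open>f \<in> E\<close> by (simp del: of_nat_Suc)
    qed
  qed (use C in simp)
  have "C \<noteq> {}" using C by (auto simp: bad_def)
  then obtain f where f: "f \<in> C" by blast
  define n where "n = nat ((t - \<phi> f) mod D)"
  have "(t - int n - \<phi> f) mod D = (t - \<phi> f - (t - \<phi> f) mod D) mod D"
    using D_pos by (simp add: n_def algebra_simps)
  also have "\<dots> = 0" by (simp add: mod_diff_right_eq)
  finally show False using no_start[OF earlier[of n] f] by blast
qed

text \<open>
  Dropping the elements outside \<open>A\<close> that start at time \<open>t\<close> does not affect the span of a pushed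
  element of \<open>A\<close>, as they are coloops of the active set when they are not pushable. This makes
  elements outside \<open>A\<close> independent over \<open>A\<close> and not just over the active part of \<open>A\<close>.
\<close>

definition running :: "'a set \<Rightarrow> ('a \<Rightarrow> int) \<Rightarrow> int \<Rightarrow> 'a set" where
  "running A \<phi> t = {f \<in> active \<phi> t. f \<in> A \<or> (t - \<phi> f) mod D \<noteq> 0}"

lemma running_subset: "running A \<phi> t \<subseteq> active \<phi> t"
  by (auto simp: running_def)

text \<open>A push within \<open>A\<close> never shrinks the span of a running set: at a starting
  time of \<open>e\<close> the loss of \<open>e\<close> keeps the rank, and at other times nothing
  is lost.\<close>

lemma spanned_running_push:
  assumes A: "A \<subseteq> E" and e: "e \<in> A" "pushable \<phi> e"
    and stuck: "\<And>f. f \<in> E - A \<Longrightarrow> \<not> pushable \<phi> f"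
    and x: "x \<in> E" "r (insert x (running A \<phi> t)) = r (running A \<phi> t)"
  shows "r (insert x (running A (push \<phi> e) t)) = r (running A (push \<phi> e) t)"
proof (cases "(t - \<phi> e) mod D = 0")
  case True
  define X where "X = active \<phi> t"
  define R where "R = running A \<phi> t"
  define N where "N = X - R"
  have XE: "X \<subseteq> E" "R \<subseteq> X" using active_subset running_subset by (auto simp: X_def R_def)
  have X_eq: "X = active \<phi> (\<phi> e)" using True active_cong by (simp add: X_def)
  have eR: "e \<in> R" using e X_eq by (auto simp: R_def running_def pushable_def X_def)
  have eX: "r (X - {e}) = r X" using e X_eq by (simp add: pushable_def)
  have "r (X - {f}) < r X" if "f \<in> N" for f
  proof -
    have f: "f \<in> E - A" "f \<in> X" "(t - \<phi> f) mod D = 0"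
      using that XE by (auto simp: N_def R_def running_def X_def)
    then have "X = active \<phi> (\<phi> f)" using active_cong by (simp add: X_def)
    then have "r (X - {f}) \<noteq> r X" using stuck[OF f(1)] f(2) by (simp add: pushable_def)
    moreover have "r (X - {f}) \<le> r X" using XE by (intro rank_mono) auto
    ultimately show ?thesis by simp
  qed
  \<comment> \<open>Chain: \<open>r R + card N \<le> r X = r (X - {e}) \<le> r (R - {e}) + card
    N\<close>. Cancelling \<open>card N\<close> shows that \<open>R\<close> does not lose rank with
    \<open>e\<close>.\<close>
  then have "r (X - N) + card N \<le> r X"
    using XE by (intro rank_Diff_coloops) (auto simp: N_def)
  moreover have "X - N = R" using XE by (auto simp: N_def)
  moreover have "(R - {e}) \<union> N = X - {e}" using XE eR by (auto simp: N_def)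
  moreover have "r ((R - {e}) \<union> N) \<le> r (R - {e}) + card N"
    using XE by (intro rank_Un_le_card) (auto simp: N_def)
  ultimately have "r R \<le> r (R - {e})" using eX by simp
  moreover have "r (insert x (R - {e})) \<le> r (insert x R)"
    using x XE by (intro rank_mono) auto
  moreover have "r (R - {e}) \<le> r (insert x (R - {e}))"
    using x XE by (intro rank_mono) auto
  moreover have "running A (push \<phi> e) t = R - {e}"
    using e unfolding running_def R_def active_push_start[of t \<phi> e, OF True] by (auto simp: push_def)
  ultimately show ?thesis using x by (simp add: R_def)
next
  case False
  show ?thesis
  proof (rule rank_insert_eq_mono[OF x(2)])
    show "running A \<phi> t \<subseteq> running A (push \<phi> e) t"
      using active_push_mono[of t \<phi> e, OF False] e unfolding running_def by (auto simp: push_def)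
    show "running A (push \<phi> e) t \<subseteq> E" using active_subset running_subset by blast
  qed (rule x)
qed

text \<open>Active sets span \<open>A\<close> and are independent over \<open>A\<close> outside it,
  so each has at least \<open>r A\<close> elements in \<open>A\<close>. Counting over one period
  against \<open>dense\<close> forces equality, and the cardinalities add up to the rank.\<close>

lemma active_independent_if_running_spans:
  assumes A: "A \<subseteq> E" and dense: "w * int (card A) \<le> D * int (r A)"
    and stuck: "\<And>f. f \<in> E - A \<Longrightarrow> \<not> pushable \<phi> f"
    and spans: "\<And>e t. e \<in> A \<Longrightarrow> r (insert e (running A \<phi> t)) = r (running A \<phi> t)"
  shows "r (active \<phi> t) = card (active \<phi> t)"
proof -
  have spans': "r (A \<union> X) = r X" if "running A \<phi> s \<subseteq> X" "X \<subseteq> E" for X s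
  proof (rule rank_Un_eq)
    show "r (insert e X) = r X" if "e \<in> A" for e
      by (rule rank_insert_eq_mono[OF spans[OF that]]) (use \<open>running A \<phi> s \<subseteq> X\<close> \<open>X \<subseteq> E\<close> A that in auto)
  qed (use that A in auto)
  have over: "r (A \<union> active \<phi> s) = r A + card (active \<phi> s - A)" for s
  proof (rule active_independent_over[OF A])
    fix f assume f: "f \<in> E - A" "f \<in> active \<phi> (\<phi> f)"
    let ?X = "active \<phi> (\<phi> f)"
    \<comment> \<open>As \<open>f\<close> lies outside \<open>A\<close> and starts now, it is not
      running. Hence \<open>?X - {f}\<close> still contains the running set and spans
      \<open>A\<close>, and a coloop of \<open>?X\<close> is also one of
      \<open>A \<union> ?X\<close>.\<close>
    have "r (A \<union> (?X - {f})) = r (?X - {f})"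
      using f active_subset by (intro spans'[of "\<phi> f"]) (auto simp: running_def)
    moreover have "r (A \<union> ?X) = r ?X"
      using active_subset running_subset by (intro spans'[of "\<phi> f"]) auto
    moreover have "r (?X - {f}) \<noteq> r ?X" using stuck[OF f(1)] f(2) by (simp add: pushable_def)
    moreover have "r (?X - {f}) \<le> r ?X" using active_subset by (intro rank_mono) auto
    moreover have "A \<union> ?X - {f} = A \<union> (?X - {f})" using f by auto
    ultimately show "r (A \<union> ?X - {f}) < r (A \<union> ?X)" by simp
  qed
  have r_active: "r (active \<phi> s) = r A + card (active \<phi> s - A)" for s
    using spans'[of s "active \<phi> s"] over[of s] active_subset running_subset by auto
  have ge: "r A \<le> card (active \<phi> s \<inter> A)" for s
  proof -
    have "r ((active \<phi> s \<inter> A) \<union> (active \<phi> s - A)) \<le> r (active \<phi> s \<inter> A) + card (active \<phi> s - A)"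
      using active_subset by (intro rank_Un_le_card) auto
    moreover have "(active \<phi> s \<inter> A) \<union> (active \<phi> s - A) = active \<phi> s" by auto
    moreover have "r (active \<phi> s \<inter> A) \<le> card (active \<phi> s \<inter> A)"
      using active_subset by (intro rank_le_card) auto
    ultimately show ?thesis using r_active[of s] by simp
  qed
  have eq: "card (active \<phi> s \<inter> A) = r A" if s: "s \<in> {0..<D}" for s
  proof (rule ccontr)
    assume "card (active \<phi> s \<inter> A) \<noteq> r A"
    \<comment> \<open>A surplus at a single time already exceeds the total that \<open>dense\<close>
      allows.\<close>
    then have "(\<Sum>t\<in>{0..<D}. r A) < (\<Sum>t\<in>{0..<D}. card (active \<phi> t \<inter> A))"
      using ge s by (intro sum_strict_mono_ex1) (auto intro!: bexI[of _ s] le_neq_implies_less)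
    then have "nat D * r A < nat w * card A" using sum_card_active[OF A] by simp
    then have "int (nat D * r A) < int (nat w * card A)" by (simp only: of_nat_less_iff)
    then show False using dense D_pos w_nonneg by simp
  qed
  have per: "active \<phi> t = active \<phi> (t mod D)" by (rule active_cong) (simp add: mod_simps)
  have "card (active \<phi> (t mod D)) = card (active \<phi> (t mod D) \<inter> A) + card (active \<phi> (t mod D) - A)"
    by (rule card_Int_Diff) simp
  then show ?thesis using eq[of "t mod D"] r_active[of "t mod D"] D_pos per by simp
qed

section \<open>Endless pushing leads to a contradiction\<close>

theorem ex_independent_placement:
  assumes dense: "\<And>A. A \<subseteq> E \<Longrightarrow> w * int (card A) \<le> D * int (r A)"
  shows "\<exists>\<phi>. \<forall>t. r (active \<phi> t) = card (active \<phi> t)"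
proof (rule ccontr)
  assume dependent: "\<not> ?thesis"
  have "\<exists>e. pushable \<phi> e \<and> (\<forall>f. pushable \<phi> f \<longrightarrow> \<phi> e \<le> \<phi> f)" for \<phi>
  proof -
    have "\<exists>e. pushable \<phi> e"
    proof (rule ccontr)
      assume none: "\<nexists>e. pushable \<phi> e"
      \<comment> \<open>With nothing pushable, the case of empty \<open>A\<close> gives independence
        at all times.\<close>
      have "r ({} \<union> active \<phi> t) = r {} + card (active \<phi> t - {})" for t
      proof (rule active_independent_over)
        fix f assume f: "f \<in> active \<phi> (\<phi> f)"
        have "r (active \<phi> (\<phi> f) - {f}) \<le> r (active \<phi> (\<phi> f))"
          using active_subset by (intro rank_mono) auto
        then show "r ({} \<union> active \<phi> (\<phi> f) - {f}) < r ({} \<union> active \<phi> (\<phi> f))"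
          using none f by (auto simp: pushable_def le_less)
      qed simp
      then show False using dependent by (auto simp: rank_empty)
    qed
    moreover have "finite {e. pushable \<phi> e}"
      by (rule finite_subset[OF _ finite_ground]) (auto simp: pushable_def active_def)
    ultimately show ?thesis
      using arg_min_if_finite[of "{e. pushable \<phi> e}" \<phi>] by (metis empty_iff mem_Collect_eq not_less)
  qed
  then obtain pick where pick: "\<And>\<phi>. pushable \<phi> (pick \<phi>)"
    and lowest: "\<And>\<phi> f. pushable \<phi> f \<Longrightarrow> \<phi> (pick \<phi>) \<le> \<phi> f" by metis
  define \<Phi> where "\<Phi> n = ((\<lambda>\<phi>. push \<phi> (pick \<phi>)) ^^ n) (\<lambda>_. 0)" for n
  define c where "c n = pick (\<Phi> n)" for n
  define A where "A = {e. infinite {n. c n = e}}"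
  have \<Phi>_Suc: "\<Phi> (Suc n) = push (\<Phi> n) (c n)" for n by (simp add: \<Phi>_def c_def)
  have c_push: "pushable (\<Phi> n) (c n)" for n by (simp add: c_def pick)
  have cE: "c n \<in> E" for n using c_push[of n] by (simp add: pushable_def active_def)
  have A: "A \<subseteq> E"
  proof
    fix e assume "e \<in> A"
    then have "{n. c n = e} \<noteq> {}" unfolding A_def by fastforce
    then show "e \<in> E" using cE by blast
  qed
  have finA: "finite A" using A finite_ground finite_subset by blast
  have mono: "\<Phi> m e \<le> \<Phi> n e" if "m \<le> n" for m n e
    using that by (induction rule: dec_induct) (auto simp: \<Phi>_Suc push_def)
  \<comment> \<open>Elements outside \<open>A\<close> are pushed finitely often, so from some step
    \<open>N0\<close> on only elements of \<open>A\<close> move.\<close>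
  have "finite (\<Union>e\<in>E - A. {n. c n = e})" using finite_ground by (auto simp: A_def)
  then obtain N0 where N0: "\<And>n. n \<in> (\<Union>e\<in>E - A. {n. c n = e}) \<Longrightarrow> n < N0"
    using finite_nat_set_iff_bounded by metis
  have cA: "c n \<in> A" if "n \<ge> N0" for n using N0[of n] that cE[of n] by fastforce
  have fixed: "\<Phi> n f = \<Phi> N0 f" if "n \<ge> N0" "f \<notin> A" for n f
    using that(1)
  proof (induction rule: dec_induct)
    case (step n)
    then show ?case using cA[of n] that(2) by (auto simp: \<Phi>_Suc push_def)
  qed simp
  \<comment> \<open>Heights rise by single units, so an element of \<open>A\<close> skips no
    integer; this is used both to pass \<open>K\<close> and to reach a prescribed residue.\<close>
  have hit: "\<exists>n\<ge>N. \<Phi> n e = \<Phi> N e + int k" if e: "e \<in> A" for e N k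
  proof (induction k)
    case (Suc k)
    then obtain n where n: "n \<ge> N" "\<Phi> n e = \<Phi> N e + int k" by blast
    have "\<exists>m\<ge>n. c m = e" using e unfolding A_def by (auto simp: infinite_nat_iff_unbounded_le)
    then obtain m where m: "m \<ge> n" "c m = e" and least: "\<And>l. n \<le> l \<Longrightarrow> c l = e \<Longrightarrow> m \<le> l"
      using ex_has_least_nat[of "\<lambda>m. n \<le> m \<and> c m = e" _ "\<lambda>m. m"] by metis
    have "l \<le> m \<Longrightarrow> \<Phi> l e = \<Phi> n e" if "n \<le> l" for l
      using that
    proof (induction rule: dec_induct)
      case (step l)
      then have "c l \<noteq> e" using least[of l] by auto
      then show ?case using step by (auto simp: \<Phi>_Suc push_def)
    qed simp
    then have "\<Phi> (Suc m) e = \<Phi> N e + int (Suc k)" using m n by (simp add: \<Phi>_Suc push_def)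
    then show ?case using m n by (intro exI[of _ "Suc m"]) auto
  qed auto
  \<comment> \<open>From step \<open>N0\<close> on, \<open>K\<close> bounds the heights outside
    \<open>A\<close>. The extra \<open>0\<close> only makes the set under \<open>Max\<close> visibly
    nonempty.\<close>
  define K where "K = Max (insert 0 (\<Phi> N0 ` E))"
  have K: "\<Phi> N0 f \<le> K" if "f \<in> E" for f using that finite_ground by (auto simp: K_def)
  have "\<forall>\<^sub>F n in sequentially. \<Phi> n e > K" if e: "e \<in> A" for e
  proof -
    obtain n where "\<Phi> n e = \<Phi> N0 e + int (nat (K + 1 - \<Phi> N0 e))" using hit[OF e] by blast
    then have "\<Phi> n e > K" by simp
    then show ?thesis using mono[of n _ e] unfolding eventually_sequentially by (metis less_le_trans)
  qed
  then have "\<forall>\<^sub>F n in sequentially. \<forall>e\<in>A. \<Phi> n e > K" using finA by (intro eventually_ball_finite) auto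
  then obtain N1 where N1: "\<And>n e. n \<ge> N1 \<Longrightarrow> e \<in> A \<Longrightarrow> \<Phi> n e > K"
    unfolding eventually_sequentially by metis
  define N where "N = max N0 N1"
  \<comment> \<open>The lowest pushable element lies in \<open>A\<close>, hence above
    \<open>K\<close>, whereas \<open>f\<close> is at most at \<open>K\<close>.\<close>
  have stuck: "\<not> pushable (\<Phi> n) f" if n: "n \<ge> N" and f: "f \<in> E - A" for n f
  proof
    assume "pushable (\<Phi> n) f"
    then have "\<Phi> n (c n) \<le> \<Phi> n f" by (simp add: c_def lowest)
    moreover have "\<Phi> n f \<le> K" using fixed[of n f] K[of f] n f by (simp add: N_def)
    moreover have "\<Phi> n (c n) > K" using N1[of n "c n"] cA[of n] n by (simp add: N_def)
    ultimately show False by simp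
  qed
  define sp where "sp n e t \<longleftrightarrow> r (insert e (running A (\<Phi> n) t)) = r (running A (\<Phi> n) t)" for n e t
  have persist: "sp n e t" if "sp m e t" "m \<le> n" "N \<le> m" "e \<in> A" for m n e t
    using that(2)
  proof (induction rule: dec_induct)
    case (step n)
    then show ?case unfolding sp_def \<Phi>_Suc using that A
      by (intro spanned_running_push cA c_push stuck) (auto simp: N_def)
  qed (use that in simp)
  have "\<forall>\<^sub>F n in sequentially. sp n e t" if e: "e \<in> A" for e t
  proof -
    \<comment> \<open>The rise is chosen so that \<open>e\<close> has age \<open>0\<close> at time
      \<open>t\<close>; then \<open>e\<close> is itself running, hence spanned, and
      \<open>persist\<close> keeps it spanned.\<close>
    obtain n where n: "n \<ge> N" "\<Phi> n e = \<Phi> N e + int (nat ((t - \<Phi> N e) mod D))" using hit[OF e] by blast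
    then have "t - \<Phi> n e = (t - \<Phi> N e) - (t - \<Phi> N e) mod D" using D_pos by simp
    then have "(t - \<Phi> n e) mod D = ((t - \<Phi> N e) - (t - \<Phi> N e) mod D) mod D" by (rule arg_cong)
    also have "\<dots> = 0" by (simp add: mod_diff_right_eq)
    finally have "(t - \<Phi> n e) mod D = 0" .
    moreover have "w > 0" using c_push[of 0] D_pos w_nonneg by (auto simp: pushable_def active_def)
    ultimately have "e \<in> running A (\<Phi> n) t" using e A by (auto simp: running_def active_def)
    then have "sp n e t" by (simp add: sp_def insert_absorb)
    then show ?thesis using persist n(1) e unfolding eventually_sequentially by blast
  qed
  \<comment> \<open>One step serves all pairs at once: \<open>A\<close> is finite, and a single
    period of times suffices.\<close>
  then have "\<forall>\<^sub>F n in sequentially. \<forall>e\<in>A. \<forall>t\<in>{0..<D}. sp n e t"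
    using finA by (intro eventually_ball_finite ballI) auto
  then obtain n1 where n1: "\<And>n e t. n \<ge> n1 \<Longrightarrow> e \<in> A \<Longrightarrow> t \<in> {0..<D} \<Longrightarrow> sp n e t"
    unfolding eventually_sequentially by metis
  define n where "n = max N n1"
  have "sp n e t" if "e \<in> A" for e t
  proof -
    have "running A (\<Phi> n) t = running A (\<Phi> n) (t mod D)"
      unfolding running_def active_def by (simp add: mod_simps)
    then show ?thesis using n1[of n e "t mod D"] that D_pos by (simp add: n_def sp_def)
  qed
  then have "r (active (\<Phi> n) t) = card (active (\<Phi> n) t)" for t
    using stuck[of n] by (intro active_independent_if_running_spans[OF A dense[OF A]])
      (auto simp: n_def sp_def)
  then show False using dependent by blast
qed

end

section \<open>Duality: from independent to spanning sets\<close>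

context rank_function
begin

lemma rank_ground_le: "X \<subseteq> E \<Longrightarrow> r E \<le> card X + r (E - X)"
  using rank_Un_le_card[of "E - X" X] by (simp add: Un_absorb2 add.commute)

text \<open>This is the rank of the dual matroid. For \<open>X \<subseteq> E\<close> the natural
  subtraction does not truncate, by \<open>rank_ground_le\<close>.\<close>

lemma dual_rank_function: "rank_function E (\<lambda>X. card X + r (E - X) - r E)"
proof
  show "card {} + r (E - {}) - r E = 0" by simp
  show "card {e} + r (E - {e}) - r E \<le> 1" for e
    using rank_mono[of "E - {e}" E] by simp
next
  fix X Y assume XY: "X \<subseteq> Y" "Y \<subseteq> E"
  then have fin: "finite X" "finite Y" using finite_ground by (auto intro: finite_subset)
  have "r ((E - Y) \<union> (Y - X)) \<le> r (E - Y) + card (Y - X)"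
    using XY by (intro rank_Un_le_card) auto
  moreover have "(E - Y) \<union> (Y - X) = E - X" using XY by auto
  moreover have "card Y = card X + card (Y - X)"
    using XY fin by (simp add: card_Diff_subset card_mono)
  ultimately show "card X + r (E - X) - r E \<le> card Y + r (E - Y) - r E" by simp
next
  fix X Y assume XY: "X \<subseteq> E" "Y \<subseteq> E"
  then have fin: "finite X" "finite Y" using finite_ground by (auto intro: finite_subset)
  have "(E - X) \<union> (E - Y) = E - X \<inter> Y" "(E - X) \<inter> (E - Y) = E - (X \<union> Y)" by auto
  then have "r (E - X \<inter> Y) + r (E - (X \<union> Y)) \<le> r (E - X) + r (E - Y)"
    using rank_submodular[of "E - X" "E - Y"] by auto
  moreover have "card X + card Y = card (X \<union> Y) + card (X \<inter> Y)"
    using fin by (rule card_Un_Int)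
  moreover have "r E \<le> card (X \<union> Y) + r (E - (X \<union> Y))" "r E \<le> card (X \<inter> Y) + r (E - X \<inter> Y)"
    using XY by (auto intro!: rank_ground_le)
  ultimately show "card (X \<union> Y) + r (E - (X \<union> Y)) - r E + (card (X \<inter> Y) + r (E - X \<inter> Y) - r E)
      \<le> card X + r (E - X) - r E + (card Y + r (E - Y) - r E)"
    by linarith
qed (rule finite_ground)

theorem ex_spanning_placement:
  fixes p k :: nat
  assumes k: "0 < k" "k \<le> p"
    and dense: "\<And>A. A \<subseteq> E \<Longrightarrow> p * (r E - r (E - A)) \<le> k * card A"
  shows "\<exists>\<psi> :: 'a \<Rightarrow> int. \<forall>t. r {e \<in> E. (\<psi> e - t) mod int p < int k} = r E"
proof -
  define r' where "r' X = card X + r (E - X) - r E" for X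
  have "rank_function E r'" unfolding r'_def by (rule dual_rank_function)
  then interpret dual: circular_placement E r' "int p" "int p - int k"
    using k by (simp add: circular_placement_def circular_placement_axioms_def)
  \<comment> \<open>Since \<open>r' A\<close> is \<open>card A\<close> minus the rank lost by
    deleting \<open>A\<close>, this is \<open>dense\<close> subtracted from \<open>p\<close> times
    \<open>card A\<close>.\<close>
  have "(int p - int k) * int (card A) \<le> int p * int (r' A)" if A: "A \<subseteq> E" for A
  proof -
    have le: "r (E - A) \<le> r E" by (rule rank_mono) auto
    have "int (r' A) = int (card A) - int (r E - r (E - A))"
      using rank_ground_le[OF A] le by (simp add: r'_def of_nat_diff)
    moreover have "int p * int (r E - r (E - A)) \<le> int k * int (card A)"
      using dense[OF A] by (metis of_nat_le_iff of_nat_mult)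
    moreover have "int p * (int (card A) - int (r E - r (E - A)))
        = int p * int (card A) - int p * int (r E - r (E - A))"
      by (rule right_diff_distrib)
    ultimately show ?thesis by (simp add: left_diff_distrib del: of_nat_diff)
  qed
  then obtain \<phi> where \<phi>: "\<And>t. r' (dual.active \<phi> t) = card (dual.active \<phi> t)"
    using dual.ex_independent_placement by blast
  \<comment> \<open>Modulo \<open>p\<close>, \<open>e\<close> is inactive exactly at the
    \<open>k\<close> times \<open>\<phi> e - k\<close> to \<open>\<phi> e - 1\<close>; this explains
    the shift by one. Complements of dual independent sets are spanning.\<close>
  have "r {e \<in> E. (\<phi> e - 1 - t) mod int p < int k} = r E" for t
  proof -
    have "(\<phi> e - 1 - t) mod int p < int k \<longleftrightarrow> \<not> (t - \<phi> e) mod int p < int p - int k" for e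
    proof -
      have "(\<phi> e - 1 - t) mod int p = (int p + (- 1 - (t - \<phi> e))) mod int p"
        unfolding mod_add_self1 by (simp add: algebra_simps)
      also have "\<dots> = (int p + (- 1 - (t - \<phi> e) mod int p)) mod int p"
        by (simp only: mod_add_self1 mod_diff_right_eq)
      also have "\<dots> = int p - 1 - (t - \<phi> e) mod int p"
        using pos_mod_bound[OF dual.D_pos, of "t - \<phi> e"] pos_mod_sign[OF dual.D_pos, of "t - \<phi> e"]
        by (subst mod_pos_pos_trivial) linarith+
      finally show ?thesis by linarith
    qed
    then have "{e \<in> E. (\<phi> e - 1 - t) mod int p < int k} = E - dual.active \<phi> t"
      by (auto simp: dual.active_def)
    then show ?thesis
      using \<phi>[of t] rank_ground_le[OF dual.active_subset, of \<phi> t] by (simp add: r'_def)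
  qed
  then show ?thesis by (intro exI[of _ "\<lambda>e. \<phi> e - 1"]) simp
qed

end

section \<open>The rank function of a matroid given by independent sets\<close>

context finite_matroid
begin

lemma finite_indep_subsets: "finite {I. I \<subseteq> A \<and> indep I}"
  by (rule finite_subset[of _ "Pow E"]) (use finite_ground indep_subset_ground in auto)

lemma card_le_rank_of: "indep I \<Longrightarrow> I \<subseteq> A \<Longrightarrow> card I \<le> rank_of indep A"
  unfolding rank_of_def using finite_indep_subsets by (intro Max_ge) auto

lemma ex_basis: "\<exists>I. I \<subseteq> A \<and> indep I \<and> card I = rank_of indep A"
proof -
  have "rank_of indep A \<in> card ` {I. I \<subseteq> A \<and> indep I}"
    unfolding rank_of_def using finite_indep_subsets indep_empty by (intro Max_in) auto
  then show ?thesis by auto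
qed

lemma extend_to_basis:
  assumes "indep I" "I \<subseteq> A"
  shows "\<exists>J. I \<subseteq> J \<and> J \<subseteq> A \<and> indep J \<and> card J = rank_of indep A"
  using assms
proof (induction "rank_of indep A - card I" arbitrary: I rule: less_induct)
  case less
  show ?case
  proof (cases "card I = rank_of indep A")
    case False
    then have lt: "card I < rank_of indep A" using card_le_rank_of[OF less.prems] by simp
    obtain B where B: "B \<subseteq> A" "indep B" "card B = rank_of indep A" using ex_basis by blast
    then obtain x where x: "x \<in> B - I" "indep (insert x I)"
      using indep_augment[of I B] lt less.prems by auto
    have "finite I" using less.prems finite_ground indep_subset_ground finite_subset by metis
    then have "card (insert x I) = Suc (card I)" using x by simp
    then have "\<exists>J. insert x I \<subseteq> J \<and> J \<subseteq> A \<and> indep J \<and> card J = rank_of indep A"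
      using lt x B less.prems by (intro less.hyps) auto
    then show ?thesis by blast
  qed (use less.prems in blast)
qed

lemma rank_function_rank_of: "rank_function E (rank_of indep)"
proof
  show "rank_of indep {} = 0" using ex_basis[of "{}"] by auto
  show "rank_of indep {e} \<le> 1" for e
  proof -
    obtain I where "I \<subseteq> {e}" "card I = rank_of indep {e}" using ex_basis[of "{e}"] by blast
    then show ?thesis using card_mono[of "{e}" I] by simp
  qed
next
  fix X Y :: "'a set" assume XY: "X \<subseteq> Y"
  obtain I where "I \<subseteq> X" "indep I" "card I = rank_of indep X" using ex_basis[of X] by blast
  then show "rank_of indep X \<le> rank_of indep Y" using XY card_le_rank_of[of I Y] by auto
next
  fix X Y :: "'a set"
  \<comment> \<open>For submodularity, a basis \<open>I\<close> of the intersection is extended to a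
    basis \<open>J\<close> of the union; \<open>J \<inter> X\<close> and \<open>J \<inter> Y\<close>
    together count \<open>J\<close> once and at least \<open>I\<close> a second time.\<close>
  obtain I where I: "I \<subseteq> X \<inter> Y" "indep I" "card I = rank_of indep (X \<inter> Y)"
    using ex_basis[of "X \<inter> Y"] by blast
  then obtain J where J: "I \<subseteq> J" "J \<subseteq> X \<union> Y" "indep J" "card J = rank_of indep (X \<union> Y)"
    using extend_to_basis[of I "X \<union> Y"] by blast
  have fin: "finite J" using J(3) finite_ground indep_subset_ground finite_subset by metis
  have "card (J \<inter> X) + card (J \<inter> Y) = card ((J \<inter> X) \<union> (J \<inter> Y)) + card ((J \<inter> X) \<inter> (J \<inter> Y))"
    using fin by (intro card_Un_Int) auto
  moreover have "(J \<inter> X) \<union> (J \<inter> Y) = J" using J by auto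
  moreover have "card I \<le> card ((J \<inter> X) \<inter> (J \<inter> Y))" using I J fin by (intro card_mono) auto
  moreover have "card (J \<inter> X) \<le> rank_of indep X" "card (J \<inter> Y) \<le> rank_of indep Y"
    using J by (auto intro!: card_le_rank_of elim: indep_subset)
  ultimately show "rank_of indep (X \<union> Y) + rank_of indep (X \<inter> Y) \<le> rank_of indep X + rank_of indep Y"
    using I J by simp
qed (rule finite_ground)

end

section \<open>From the integer grid to the circle\<close>

lemma circle_pt_eqI: "[s = t] (rmod d) \<Longrightarrow> circle_pt d s = circle_pt d t"
  unfolding circle_pt_def
  by (intro equiv_class_eq[OF equiv_circle_rel]) (simp add: circle_rel_def)

text \<open>The ceiling is the index of the first grid point at or after \<open>t\<close>. It and
  the next \<open>k - 1\<close> points, at spacing \<open>d / p\<close>, stay strictly before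
  \<open>t + k * d / p\<close>, hence before \<open>t + 1\<close>.\<close>

lemma circle_pt_grid_in_arc:
  fixes a :: int and p k :: nat
  assumes d: "d > 0" "d * real k \<le> real p" and p: "p > 0"
    and a: "(a - \<lceil>t * real p / d\<rceil>) mod int p < int k"
  shows "circle_pt d (a * (d / p)) \<in> circle_pt d ` {t..<t + 1}"
proof -
  define n where "n = \<lceil>t * real p / d\<rceil>"
  define j where "j = (a - n) mod int p"
  define q where "q = (a - n) div int p"
  have j: "0 \<le> j" "j + 1 \<le> int k" using a p by (auto simp: j_def n_def)
  have n: "t * real p / d \<le> of_int n" "of_int n < t * real p / d + 1"
    unfolding n_def by linarith+
  have a_eq: "a = (n + j) + q * int p"
    unfolding j_def q_def using div_mult_mod_eq[of "a - n" "int p"] by linarith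
  \<comment> \<open>Removing the \<open>q\<close> full turns gives the representative that lies in
    the real interval.\<close>
  define s where "s = of_int (n + j) * (d / real p)"
  have "of_int a * (d / real p) = s + of_int q * d"
    using p unfolding a_eq s_def by (simp add: field_simps)
  then have "circle_pt d s = circle_pt d (of_int a * (d / real p))"
    by (intro circle_pt_eqI) (auto simp: rcong_altdef)
  moreover have "t * real p / d \<le> of_int (n + j)" using n j by simp
  then have "t \<le> s" using d p by (simp add: s_def field_simps)
  moreover have "of_int (j + 1) \<le> (of_int (int k) :: real)" using j(2) by (simp only: of_int_le_iff)
  then have "of_int (n + j) < t * real p / d + real k" using n j by simp
  then have "s < (t * real p / d + real k) * (d / real p)"
    unfolding s_def using d p by (intro mult_strict_right_mono) auto
  moreover have "(t * real p / d + real k) * (d / real p) = t + d * real k / real p"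
    using d p by (simp add: field_simps)
  moreover have "d * real k / real p \<le> 1" using d p by simp
  ultimately show ?thesis by (intro image_eqI[of _ _ s]) auto
qed

theorem theorem4p2:
  fixes E :: "'a set" and indep :: "'a set \<Rightarrow> bool" and d :: real
  assumes "finite_matroid E indep"
    and "loopless E indep"
    and "d > 0"
    and "\<And>A. A \<subseteq> E \<Longrightarrow> rank_of indep (E - A) < rank_of indep E \<Longrightarrow>
           d \<le> real (card A) / (real (rank_of indep E) - real (rank_of indep (E - A)))"
  shows "\<exists>\<phi> :: 'a \<Rightarrow> real set. (\<forall>e\<in>E. \<phi> e \<in> circle d) \<and>
           (\<forall>x\<in>circle d. spanning E indep {e \<in> E. \<phi> e \<in> unit_arc d x})"
proof (cases "E = {}")
  case True
  then show ?thesis by (simp add: spanning_def)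
next
  case False
  interpret finite_matroid E indep by fact
  interpret rank_function E "rank_of indep" by (rule rank_function_rank_of)
  let ?r = "rank_of indep"
  define def where "def A = ?r E - ?r (E - A)" for A
  define S where "S = {A. A \<subseteq> E \<and> def A > 0}"
  obtain e where "e \<in> E" using False by blast
  \<comment> \<open>Looplessness gives \<open>E\<close> positive rank, so the minimum of the ratios
    is taken over a nonempty set.\<close>
  then have "?r E > 0" using card_le_rank_of[of "{e}" E] assms(2) by (simp add: loopless_def)
  then have "E \<in> S" by (simp add: S_def def_def rank_empty)
  moreover have "finite S" using finite_ground by (simp add: S_def)
  ultimately obtain A where A: "A \<in> S"
    and "\<not> (\<exists>B\<in>S. real (card B) / def B < real (card A) / def A)"
    using arg_min_if_finite[of S "\<lambda>A. real (card A) / def A"] by blast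
  then have least: "real (card A) / def A \<le> real (card B) / def B" if "B \<in> S" for B
    using that not_less by blast
  \<comment> \<open>Though \<open>d\<close> may be irrational, the minimal ratio
    \<open>p / k\<close> is attained and at least \<open>d\<close>, which gives integer
    parameters.\<close>
  define p k where "p = card A" and "k = def A"
  have k: "0 < k" using A by (simp add: S_def k_def)
  have "k \<le> p" using rank_ground_le[of A] A by (simp add: S_def k_def p_def def_def)
  have "p * def B \<le> k * card B" if "B \<subseteq> E" for B
  proof (cases "B \<in> S")
    case True
    then have "real p * real (def B) \<le> real k * real (card B)"
      using least[of B] k by (simp add: S_def p_def k_def field_simps)
    then show ?thesis by (metis of_nat_le_iff of_nat_mult)
  qed (use that in \<open>simp add: S_def\<close>)
  then obtain \<psi> :: "'a \<Rightarrow> int" where \<psi>: "\<And>t. ?r {e \<in> E. (\<psi> e - t) mod int p < int k} = ?r E"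
    using ex_spanning_placement[OF k \<open>k \<le> p\<close>] unfolding def_def by blast
  have "d \<le> real p / real k"
    using assms(4)[of A] A by (simp add: S_def p_def k_def def_def of_nat_diff)
  then have dk: "d * real k \<le> real p" using k by (simp add: field_simps)
  \<comment> \<open>The \<open>p\<close> grid points at spacing \<open>d / p\<close> close up after
    one turn; by \<open>dk\<close>, the steps fit \<open>k\<close> to a unit arc.\<close>
  define \<phi> where "\<phi> e = circle_pt d (\<psi> e * (d / p))" for e
  have "spanning E indep {e \<in> E. \<phi> e \<in> unit_arc d x}" if x: "x \<in> circle d" for x
  proof -
    obtain t where t: "x = circle_pt d t"
      using x unfolding circle_def circle_pt_def quotient_def by blast
    have "{e \<in> E. (\<psi> e - \<lceil>t * real p / d\<rceil>) mod int p < int k} \<subseteq> {e \<in> E. \<phi> e \<in> unit_arc d x}"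
      unfolding t unit_arc_circle_pt \<phi>_def
      using circle_pt_grid_in_arc[OF assms(3) dk] k \<open>k \<le> p\<close> by auto
    then have "?r {e \<in> E. (\<psi> e - \<lceil>t * real p / d\<rceil>) mod int p < int k}
        \<le> ?r {e \<in> E. \<phi> e \<in> unit_arc d x}"
      by (rule rank_mono) auto
    then have "?r E \<le> ?r {e \<in> E. \<phi> e \<in> unit_arc d x}" by (simp only: \<psi>)
    moreover have "?r {e \<in> E. \<phi> e \<in> unit_arc d x} \<le> ?r E" by (intro rank_mono) auto
    ultimately show ?thesis by (auto simp: spanning_def)
  qed
  moreover have "\<phi> e \<in> circle d" for e
    by (simp add: \<phi>_def circle_def circle_pt_def quotientI)
  ultimately show ?thesis by blast
qed

end
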